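(* Let $k=4$ and $r_1\ge r_2\ge r_3\ge r_4\ge 1$. If $(r_1-1)< (r_2-1)+(r_3-1)-(r_4-1)$, then the arithmetic mean component competitive ratio for the 4-objective time series search problem is $$z_f^4=\frac18\left[\sqrt{4r_3+\{(r_1-1)-(r_2-1)+(r_4-1)\}^2}+(r_1+1)+(r_2+1)+(r_4+1)\right].$$
   Context: For an integer $k\ge 2$ and reals $0<m_i\le M_i$ ($1\le i\le k$), let $r_i=M_i/m_i$ be the fluctuation ratio of the price interval $[m_i,M_i]$ of the $i$th objective. It is assumed throughout that $r_1\ge\cdots\ge r_k\ge 1$. The arithmetic mean component competitive ratio of the $k$-objective time series search problem is the quantity $$z_f^k=\sup_{(x_1,\ldots,x_k)\in\mathcal{S}_f^k}\frac1k\left(\frac{M_1}{x_1}+\cdots+\frac{M_k}{x_k}\right),$$ where $$\mathcal{S}_f^k=\left\{(x_1,\ldots,x_k)\in[m_1,M_1]\times\cdots\times[m_k,M_k] : \frac1k\sum_{i=1}^k\frac{x_i}{m_i}=\frac1k\sum_{i=1}^k\frac{M_i}{x_i}\right\}.$$ *)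

theory Defs
  imports Complex_Main "HOL-Library.FuncSet"
begin

text \<open>The price interval of the \<open>i\<close>-th objective, \<open>1 \<le> i \<le> k\<close>, is \<open>{m i..M i}\<close>.\<close>

definition fluctuation_ratio :: "(nat \<Rightarrow> real) \<Rightarrow> (nat \<Rightarrow> real) \<Rightarrow> nat \<Rightarrow> real" where
  "fluctuation_ratio m M i = M i / m i"

text \<open>
  Price vectors \<open>(x\<^sub>1, \<dots>, x\<^sub>k)\<close> are encoded as functions on the index set \<open>{1..k}\<close>,
  extensional outside it.
\<close>

definition am_search_set ::
  "nat \<Rightarrow> (nat \<Rightarrow> real) \<Rightarrow> (nat \<Rightarrow> real) \<Rightarrow> (nat \<Rightarrow> real) set" where
  "am_search_set k m M =
     {x \<in> (\<Pi>\<^sub>E i\<in>{1..k}. {m i..M i}).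
        1 / real k * (\<Sum>i=1..k. x i / m i) = 1 / real k * (\<Sum>i=1..k. M i / x i)}"

text \<open>
  The supremum is taken in the reals.  For \<open>0 < m i \<le> M i\<close> it is genuine: the set contains
  the point with coordinates \<open>sqrt (m i * M i)\<close>, and every \<open>M i / x i\<close> is at most \<open>M i / m i\<close>.
\<close>

definition am_competitive_ratio ::
  "nat \<Rightarrow> (nat \<Rightarrow> real) \<Rightarrow> (nat \<Rightarrow> real) \<Rightarrow> real" where
  "am_competitive_ratio k m M =
     (SUP x\<in>am_search_set k m M. 1 / real k * (\<Sum>i=1..k. M i / x i))"

end

theory Submission imports Defs begin

text \<open>
  Put \<open>u\<^sub>i = x\<^sub>i / m\<^sub>i\<close> and \<open>v\<^sub>i = M\<^sub>i / x\<^sub>i\<close>, so that \<open>u\<^sub>i, v\<^sub>i \<ge> 1\<close>, \<open>u\<^sub>i v\<^sub>i = r\<^sub>i\<close>, and on the search set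
  \<open>\<Sum> u\<^sub>i = \<Sum> v\<^sub>i\<close> equals half of \<open>\<Sum> (u\<^sub>i + v\<^sub>i)\<close>.  Since \<open>u\<^sub>i + v\<^sub>i = r\<^sub>i + 1 - (u\<^sub>i - 1) (v\<^sub>i - 1)\<close>, one
  has to minimise the total loss \<open>\<Sum> (u\<^sub>i - 1) (v\<^sub>i - 1)\<close>.  The loss of a coordinate is a concave
  function of its slack \<open>r\<^sub>i - 1 - \<bar>u\<^sub>i - v\<^sub>i\<bar>\<close> and increases with \<open>r\<^sub>i\<close>.  The balance condition
  forces the slacks of the first three coordinates to sum to at least
  \<open>(r\<^sub>2 - 1) + (r\<^sub>3 - 1) - (r\<^sub>1 - 1) - (r\<^sub>4 - 1) > 0\<close>, and the cheapest way to pay for this slack is to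
  concentrate it on the third coordinate, where the ratio is smallest.
\<close>

text \<open>
  The loss \<open>(U - 1) (V - 1)\<close> either exceeds the optimal loss \<open>(P - 1) (Q - 1)\<close> or lies above the
  chord from the origin to the optimum, whose slope in terms of the slack is \<open>(Q - 1) / (Q + 1)\<close>.
\<close>

lemma loss_above_chord_aux:
  fixes P Q U V :: real
  assumes "1 \<le> P" "P \<le> Q" "1 \<le> U" "U \<le> V" "P * Q \<le> U * V"
  shows "(P - 1) * (Q - 1) \<le> (U - 1) * (V - 1) \<or>
    (Q - 1) * (U * V - 1 - \<bar>U - V\<bar>) \<le> (Q + 1) * ((U - 1) * (V - 1))"
proof (cases "Q \<le> V")
  case True
  have "0 \<le> (U - 1) * (V - Q)"
    using assms True by simp
  moreover have "\<bar>U - V\<bar> = V - U"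
    using assms by simp
  ultimately have "(Q - 1) * (U * V - 1 - \<bar>U - V\<bar>) \<le> (Q + 1) * ((U - 1) * (V - 1))"
    by (simp add: algebra_simps)
  then show ?thesis ..
next
  case False
  have "P * Q \<le> U * Q"
    using assms False mult_left_mono[of V Q U] by linarith
  then have "P \<le> U"
    using assms by simp
  then have "0 \<le> (U - P) * (Q - U)"
    using assms False by simp
  moreover have "0 \<le> (U - 1) * (U * V - P * Q)"
    using assms by simp
  \<comment> \<open>The two products add up to \<open>U\<close> times the difference of the
    losses.\<close>
  ultimately have "U * ((P - 1) * (Q - 1)) \<le> U * ((U - 1) * (V - 1))"
    by (simp add: algebra_simps)
  then show ?thesis
    using assms by simp
qed

lemma loss_above_chord:
  fixes P Q U V :: real
  assumes "1 \<le> P" "P \<le> Q" "1 \<le> U" "1 \<le> V" "P * Q \<le> U * V"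
  shows "(P - 1) * (Q - 1) \<le> (U - 1) * (V - 1) \<or>
    (Q - 1) * (U * V - 1 - \<bar>U - V\<bar>) \<le> (Q + 1) * ((U - 1) * (V - 1))"
  using loss_above_chord_aux[of P Q U V] loss_above_chord_aux[of P Q V U] assms
  by (cases "U \<le> V") (auto simp: mult.commute abs_minus_commute)

lemma abs_diff_le_mult_minus_one:
  fixes u v :: real
  assumes "1 \<le> u" "1 \<le> v"
  shows "\<bar>u - v\<bar> \<le> u * v - 1"
proof -
  have "0 \<le> (u - 1) * (v + 1)" "0 \<le> (u + 1) * (v - 1)"
    using assms by simp_all
  then show ?thesis
    by (simp add: algebra_simps abs_le_iff)
qed

text \<open>\<open>P\<close> and \<open>Q\<close> are \<open>u 3\<close> and \<open>v 3\<close> at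
  the optimum, where the other coordinates sit at endpoints and leave the imbalance
  \<open>Q - P\<close>. Either one loss already suffices or three chord bounds add up.\<close>

lemma total_loss_ge:
  fixes P Q :: real and u v r :: "nat \<Rightarrow> real"
  assumes PQ: "1 \<le> P" "P \<le> Q" "P * Q = r 3" "Q - P = r 1 - r 2 + r 4 - 1"
    and uv: "\<And>i. i \<in> {1..4} \<Longrightarrow> 1 \<le> u i \<and> 1 \<le> v i \<and> u i * v i = r i"
    and r: "r 1 \<ge> r 2" "r 2 \<ge> r 3"
    and balanced: "u 1 + u 2 + u 3 + u 4 = v 1 + v 2 + v 3 + v 4"
  shows "(P - 1) * (Q - 1) \<le> (u 1 - 1) * (v 1 - 1) + (u 2 - 1) * (v 2 - 1)
    + (u 3 - 1) * (v 3 - 1) + (u 4 - 1) * (v 4 - 1)"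
proof -
  define l where "l i = (u i - 1) * (v i - 1)" for i
  define s where "s i = r i - 1 - \<bar>u i - v i\<bar>" for i
  have l0: "0 \<le> l i" if "i \<in> {1..4}" for i
    using uv[OF that] by (simp add: l_def)
  have s0: "0 \<le> s i" if "i \<in> {1..4}" for i
    using abs_diff_le_mult_minus_one[of "u i" "v i"] uv[OF that] by (simp add: s_def)
  have chord: "(P - 1) * (Q - 1) \<le> l i \<or> (Q - 1) * s i \<le> (Q + 1) * l i"
    if "i \<in> {1..3}" for i
  proof -
    have "i = 1 \<or> i = 2 \<or> i = 3"
      using that by auto
    then have "r 3 \<le> r i"
      using r by auto
    then show ?thesis
      using loss_above_chord[of P Q "u i" "v i"] PQ uv[of i] that by (simp add: l_def s_def)
  qed
  have "(P - 1) * (Q - 1) \<le> l 1 + l 2 + l 3"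
  proof (cases "\<exists>i\<in>{1..3}. (P - 1) * (Q - 1) \<le> l i")
    case True
    then obtain i where "i \<in> {1..3}" "(P - 1) * (Q - 1) \<le> l i"
      by blast
    moreover from this have "i = 1 \<or> i = 2 \<or> i = 3"
      by auto
    ultimately show ?thesis
      using l0[of 1] l0[of 2] l0[of 3] by auto
  next
    case False
    then have "(Q - 1) * (s 1 + s 2 + s 3) \<le> (Q + 1) * (l 1 + l 2 + l 3)"
      using chord[of 1] chord[of 2] chord[of 3] by (auto simp: distrib_left)
    moreover have "(P - 1) * (Q + 1) \<le> s 1 + s 2 + s 3"
    proof -
      \<comment> \<open>The signed differences sum to zero. Among the first three some sign occurs
        at most once, so their sizes total at most twice that one plus the fourth.\<close>
      have "\<bar>u 1 - v 1\<bar> + \<bar>u 2 - v 2\<bar> + \<bar>u 3 - v 3\<bar> \<le> 2 * (r 1 - 1) + (r 4 - 1)"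
        using balanced r s0[of 1] s0[of 2] s0[of 3] s0[of 4] unfolding s_def by simp
      then show ?thesis
        using PQ by (simp add: s_def algebra_simps)
    qed
    then have "(Q - 1) * ((P - 1) * (Q + 1)) \<le> (Q - 1) * (s 1 + s 2 + s 3)"
      using PQ by (intro mult_left_mono) auto
    ultimately have "(Q + 1) * ((P - 1) * (Q - 1)) \<le> (Q + 1) * (l 1 + l 2 + l 3)"
      by (simp add: mult_ac)
    then show ?thesis
      using PQ by simp
  qed
  then show ?thesis
    using l0[of 4] by (simp add: l_def)
qed

theorem theorem6p3:
  fixes m M r :: "nat \<Rightarrow> real"
  defines "r \<equiv> fluctuation_ratio m M"
  assumes "\<And>i. i \<in> {1..4} \<Longrightarrow> 0 < m i \<and> m i \<le> M i"
    and "r 1 \<ge> r 2" and "r 2 \<ge> r 3" and "r 3 \<ge> r 4" and "r 4 \<ge> 1"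
    and "r 1 - 1 < (r 2 - 1) + (r 3 - 1) - (r 4 - 1)"
  shows "am_competitive_ratio 4 m M =
    1 / 8 * (sqrt (4 * r 3 + ((r 1 - 1) - (r 2 - 1) + (r 4 - 1))\<^sup>2)
             + (r 1 + 1) + (r 2 + 1) + (r 4 + 1))"
proof -
  note mM = assms(2) and r = assms(3-7)
  define c where "c = (r 1 - 1) - (r 2 - 1) + (r 4 - 1)"
  define w where "w = sqrt (4 * r 3 + c\<^sup>2)"
  define P where "P = (w - c) / 2"
  define Q where "Q = (w + c) / 2"
  have c: "0 \<le> c" "c \<le> r 3 - 1"
    using r by (auto simp: c_def)
  have w2: "w * w = 4 * r 3 + c * c"
    using r by (simp add: w_def power2_eq_square)
  have PQ: "P * Q = r 3" "Q - P = c" "P + Q = w"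
    using w2 by (simp_all add: P_def Q_def field_simps)
  \<comment> \<open>Equivalent to \<open>c \<le> r 3 - 1\<close>; it yields
    \<open>c + 2 \<le> w\<close>.\<close>
  have "(c + 2)\<^sup>2 \<le> 4 * r 3 + c\<^sup>2"
    using c by (simp add: power2_eq_square algebra_simps)
  then have P1: "1 \<le> P"
    using real_le_rsqrt by (fastforce simp: P_def w_def)
  have PleQ: "P \<le> Q"
    using PQ c by simp
  have Pr: "P \<le> r 3"
    using PQ P1 PleQ mult_left_mono[of 1 Q P] by simp
  have rm: "r i * m i = M i" if "i \<in> {1..4}" for i
    using mM[OF that] by (simp add: r_def fluctuation_ratio_def)
  have sum4: "(\<Sum>i=1..4. f i) = f 1 + f 2 + f 3 + f 4" for f :: "nat \<Rightarrow> real"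
    by (simp add: eval_nat_numeral)
  define V where "V = 1 / 8 * (w + (r 1 + 1) + (r 2 + 1) + (r 4 + 1))"
  have upper: "1 / real 4 * (\<Sum>i=1..4. M i / x i) \<le> V" if x: "x \<in> am_search_set 4 m M" for x
  proof -
    define u where "u i = x i / m i" for i
    define v where "v i = M i / x i" for i
    have uv: "1 \<le> u i \<and> 1 \<le> v i \<and> u i * v i = r i" if i: "i \<in> {1..4}" for i
    proof -
      have "m i \<le> x i" "x i \<le> M i"
        using x i by (auto simp: am_search_set_def PiE_iff)
      then show ?thesis
        using mM[OF i] by (auto simp: u_def v_def r_def fluctuation_ratio_def)
    qed
    have bal: "u 1 + u 2 + u 3 + u 4 = v 1 + v 2 + v 3 + v 4"
    proof -
      have "(\<Sum>i=1..4. x i / m i) = (\<Sum>i=1..4. M i / x i)"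
        using x by (simp add: am_search_set_def)
      then show ?thesis
        unfolding sum4 u_def v_def .
    qed
    have "(P - 1) * (Q - 1) \<le> (u 1 - 1) * (v 1 - 1) + (u 2 - 1) * (v 2 - 1)
      + (u 3 - 1) * (v 3 - 1) + (u 4 - 1) * (v 4 - 1)"
      using P1 PleQ PQ r uv bal by (intro total_loss_ge[where r = r]) (auto simp: c_def)
    moreover have loss: "(u i - 1) * (v i - 1) = r i + 1 - (u i + v i)" if "i \<in> {1..4}" for i
      using uv[OF that] by (simp add: algebra_simps)
    moreover have "(P - 1) * (Q - 1) = r 3 + 1 - w"
      using PQ by (simp add: algebra_simps)
    ultimately have "2 * (v 1 + v 2 + v 3 + v 4) \<le> 8 * V"
      using bal loss[of 1] loss[of 2] loss[of 3] loss[of 4] by (simp add: V_def)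
    then show ?thesis
      unfolding sum4 v_def by simp
  qed
  \<comment> \<open>Coordinates 1, 2 and 4 sit at endpoints, with no loss; the third, with ratios
    \<open>P\<close> and \<open>Q\<close>, absorbs the imbalance \<open>c\<close> they
    leave.\<close>
  define y where "y = (\<lambda>i\<in>{1..4::nat}. if i = 2 then m 2 else if i = 3 then P * m 3 else M i)"
  have y: "y 1 = M 1" "y 2 = m 2" "y 3 = P * m 3" "y 4 = M 4"
    by (simp_all add: y_def)
  have "m 3 \<le> P * m 3" "P * m 3 \<le> M 3"
    using P1 Pr mM[of 3] rm[of 3] mult_right_mono[of P "r 3" "m 3"] by auto
  then have "y \<in> (\<Pi>\<^sub>E i\<in>{1..4}. {m i..M i})"
    using mM by (auto simp: y_def)
  moreover have My: "(\<Sum>i=1..4. M i / y i) = 1 + r 2 + Q + 1"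
  proof -
    have "M 3 / y 3 = Q"
      using P1 mM[of 3] rm[of 3, folded PQ(1)] by (auto simp: y divide_eq_eq mult_ac)
    then show ?thesis
      using mM[of 1] mM[of 4] unfolding sum4 y by (simp add: r_def fluctuation_ratio_def)
  qed
  moreover have "(\<Sum>i=1..4. y i / m i) = r 1 + 1 + P + r 4"
    using mM[of 2] mM[of 3] unfolding sum4 y by (simp add: r_def fluctuation_ratio_def)
  ultimately have "y \<in> am_search_set 4 m M"
    using PQ by (simp add: am_search_set_def c_def)
  moreover have "1 / real 4 * (\<Sum>i=1..4. M i / y i) = V"
    unfolding My V_def using PQ by (simp add: c_def)
  ultimately have "am_competitive_ratio 4 m M = V"
    unfolding am_competitive_ratio_def using upper
    by (intro cSup_eq_maximum) (auto intro!: image_eqI[where x = y])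
  then show ?thesis
    by (simp add: V_def w_def c_def)
qed

end
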